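(* Let $n\ge 1$, let $\Omega\subset\mathbb{R}^n$ be a nonempty connected open set, and let $k:\Omega\times\Omega\to\mathbb{R}$ satisfy $\int_\Omega\int_\Omega|k(s,t)|^2\,ds\,dt<\infty$. Let $T:L^2(\Omega)\to L^2(\Omega)$ be the Hilbert-Schmidt integral operator defined, for $f\in L^2(\Omega)$, by $$T(f)(s)=\int_\Omega k(s,t)f(t)\,dt,\quad s\in\Omega.$$ Let $\{\varphi_i:i\in\mathbb{N}\}$ be an orthonormal basis of $L^2(\Omega)$ and put $c_{ij}=\int_{\Omega\times\Omega}k(s,t)\varphi_i(s)\varphi_j(t)\,ds\,dt$ for $i,j\in\mathbb{N}$. Then the following hold. (i) $T$ is Fréchet differentiable on $L^2(\Omega)$ such that, for any $h\in L^2(\Omega)$, $$\nabla T(h)(f)=Tf=\sum_{i=1}^{\infty}\Big(\sum_{j=1}^{\infty}c_{ij}\langle f,\varphi_j\rangle\Big)\varphi_i,\quad\text{for any } f\in L^2(\Omega).$$ (ii) $T$ is Mordukhovich differentiable on $L^2(\Omega)$ such that, for any $h\in L^2(\Omega)$, $$\widehat{D}^*T(h)(g)=T^*g=\sum_{j=1}^{\infty}\Big(\sum_{i=1}^{\infty}c_{ij}\langle g,\varphi_i\rangle\Big)\varphi_j,\quad\text{for any } g\in L^2(\Omega).$$ (iii) The covering constant of $T$ is constant with $\hat{\alpha}(T,f,u)=0$ for any $f,u\in L^2(\Omega)$ with $u=Tf$.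
   Context: $L^2(\Omega)$ is the real Hilbert space of square-integrable real-valued functions with inner product $\langle\cdot,\cdot\rangle$ and norm $\|\cdot\|_{L^2(\Omega)}$; $T^*$ is the adjoint of $T$. Write $H=L^2(\Omega)$, and let $\mathbb{B}(x,\eta)$ denote the closed ball in $H$ with center $x$ and radius $\eta$. $\nabla F(\bar{x})$ denotes the Fréchet derivative of $F:H\to H$ at $\bar{x}$, a continuous linear map $H\to H$. For a continuous single-valued $F:H\to H$ and $x,y\in H$, the Mordukhovich derivative (coderivative) of $F$ at $x$ is the set-valued mapping $$\widehat{D}^*F(x)(y)=\left\{z\in H:\ \limsup_{u\to x}\frac{\langle z,u-x\rangle-\langle y,F(u)-F(x)\rangle}{\|u-x\|_H+\|F(u)-F(x)\|_H}\le 0\right\},$$ and $F$ is Mordukhovich differentiable at $x$ if $\widehat{D}^*F(x)(y)\ne\emptyset$ for every $y\in H$. When the value is a singleton it is identified with its element: $\widehat{D}^*F(x)(y)=v$ means $\widehat{D}^*F(x)(y)=\{v\}$. For $\bar{x},\bar{y}\in H$ with $\bar{y}=F(\bar{x})$, the covering constant is $$\hat{\alpha}(F,\bar{x},\bar{y})=\sup_{\eta>0}\inf\{\|z\|_H:\ z\in\widehat{D}^*F(x)(w),\ x\in\mathbb{B}(\bar{x},\eta),\ F(x)\in\mathbb{B}(\bar{y},\eta),\ \|w\|_H=1\}.$$ *)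

theory Defs
  imports "HOL-Analysis.Analysis"
begin

section \<open>The Hilbert space of square-integrable functions\<close>

definition square_integrable :: "('a::euclidean_space \<Rightarrow> real) \<Rightarrow> bool" where
  "square_integrable f \<longleftrightarrow>
     f \<in> borel_measurable lebesgue \<and> integrable lebesgue (\<lambda>x. (f x)\<^sup>2)"

lemma square_integrable_mult:
  assumes "square_integrable f" "square_integrable g"
  shows "integrable lebesgue (\<lambda>x. f x * g x)"
proof (rule Bochner_Integration.integrable_bound)
  show "integrable lebesgue (\<lambda>x. (f x)\<^sup>2 + (g x)\<^sup>2)"
    using assms by (auto simp: square_integrable_def)
  show "(\<lambda>x. f x * g x) \<in> borel_measurable lebesgue"
    using assms by (auto simp: square_integrable_def)
  have "\<bar>a * b\<bar> \<le> a\<^sup>2 + b\<^sup>2" for a b :: real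
  proof -
    have "0 \<le> (\<bar>a\<bar> - \<bar>b\<bar>)\<^sup>2" by simp
    then have "2 * \<bar>a * b\<bar> \<le> a\<^sup>2 + b\<^sup>2" by (simp add: power2_diff abs_mult)
    then show ?thesis by linarith
  qed
  then show "AE x in lebesgue. norm (f x * g x) \<le> norm ((f x)\<^sup>2 + (g x)\<^sup>2)"
    by (intro AE_I2) (metis abs_of_nonneg real_norm_def sum_power2_ge_zero)
qed

lemma square_integrable_zero: "square_integrable (\<lambda>x. 0)"
  by (simp add: square_integrable_def)

lemma square_integrable_scale:
  "square_integrable f \<Longrightarrow> square_integrable (\<lambda>x. c * f x)"
  unfolding square_integrable_def power_mult_distrib by auto

lemma square_integrable_add:
  assumes "square_integrable f" "square_integrable g"
  shows "square_integrable (\<lambda>x. f x + g x)"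
proof -
  have "integrable lebesgue (\<lambda>x. (f x)\<^sup>2 + (g x)\<^sup>2 + 2 * (f x * g x))"
    using assms square_integrable_mult[OF assms] by (auto simp: square_integrable_def)
  then have "integrable lebesgue (\<lambda>x. (f x + g x)\<^sup>2)"
    by (simp add: power2_sum mult.assoc)
  then show ?thesis
    using assms unfolding square_integrable_def by auto
qed

quotient_type (overloaded) 'a L2 = "'a::euclidean_space \<Rightarrow> real" /
  partial: "\<lambda>f g. square_integrable f \<and> square_integrable g \<and> (AE x in lebesgue. f x = g x)"
  morphisms rep_L2 abs_L2
proof (rule part_equivpI)
  show "\<exists>f::'a \<Rightarrow> real. square_integrable f \<and> square_integrable f \<and> (AE x in lebesgue. f x = f x)"
    using square_integrable_zero by auto
qed (auto intro!: sympI transpI elim: AE_mp)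

instantiation L2 :: (euclidean_space) real_inner
begin

lift_definition zero_L2 :: "'a L2" is "\<lambda>x. 0"
  by (simp add: square_integrable_zero)

lift_definition plus_L2 :: "'a L2 \<Rightarrow> 'a L2 \<Rightarrow> 'a L2" is "\<lambda>f g x. f x + g x"
  by (auto intro: square_integrable_add)

lift_definition uminus_L2 :: "'a L2 \<Rightarrow> 'a L2" is "\<lambda>f x. - f x"
  using square_integrable_scale[where c = "-1"] by auto

lift_definition scaleR_L2 :: "real \<Rightarrow> 'a L2 \<Rightarrow> 'a L2" is "\<lambda>c f x. c * f x"
  by (auto intro: square_integrable_scale)

definition minus_L2 :: "'a L2 \<Rightarrow> 'a L2 \<Rightarrow> 'a L2" where
  "f - g = f + (- g)" for f g :: "'a L2"

lift_definition inner_L2 :: "'a L2 \<Rightarrow> 'a L2 \<Rightarrow> real" is "\<lambda>f g. LINT x|lebesgue. f x * g x"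
  by (rule integral_cong_AE) (auto simp: square_integrable_def)

definition norm_L2 :: "'a L2 \<Rightarrow> real" where
  "norm f = sqrt (inner f f)" for f :: "'a L2"

definition dist_L2 :: "'a L2 \<Rightarrow> 'a L2 \<Rightarrow> real" where
  "dist f g = norm (f - g)" for f g :: "'a L2"

definition sgn_L2 :: "'a L2 \<Rightarrow> 'a L2" where
  "sgn f = inverse (norm f) *\<^sub>R f" for f :: "'a L2"

definition uniformity_L2 :: "('a L2 \<times> 'a L2) filter" where
  "uniformity_L2 = (INF e\<in>{0 <..}. principal {(x, y). dist x y < e})"

definition open_L2 :: "'a L2 set \<Rightarrow> bool" where
  "open_L2 U \<longleftrightarrow> (\<forall>x\<in>U. eventually (\<lambda>(x', y). x' = x \<longrightarrow> y \<in> U) uniformity)"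

instance
proof
  fix f g h :: "'a L2" and a b :: real
  show "f + g + h = f + (g + h)"
    by transfer (auto simp: add.assoc intro!: square_integrable_add)
  show "f + g = g + f"
    by transfer (auto simp: add.commute intro!: square_integrable_add)
  show "0 + f = f"
    by transfer auto
  show "- f + f = 0"
    by transfer (auto simp: square_integrable_zero)
  show "f - g = f + - g"
    by (simp add: minus_L2_def)
  show "a *\<^sub>R (f + g) = a *\<^sub>R f + a *\<^sub>R g"
    by transfer (auto simp: distrib_left intro!: square_integrable_add square_integrable_scale)
  show "(a + b) *\<^sub>R f = a *\<^sub>R f + b *\<^sub>R f"
    by transfer (auto simp: distrib_right intro!: square_integrable_add square_integrable_scale)
  show "a *\<^sub>R b *\<^sub>R f = (a * b) *\<^sub>R f"
    by transfer (auto simp: mult.assoc intro!: square_integrable_scale)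
  show "1 *\<^sub>R f = f"
    by transfer auto
  show "dist f g = norm (f - g)"
    by (simp add: dist_L2_def)
  show "sgn f = inverse (norm f) *\<^sub>R f"
    by (simp add: sgn_L2_def)
  show "uniformity = (INF e\<in>{0<..}. principal {(x, y::'a L2). dist x y < e})"
    by (simp add: uniformity_L2_def)
  show "inner f g = inner g f"
    by transfer (simp add: mult.commute)
  show "inner (f + g) h = inner f h + inner g h"
    by transfer (simp add: distrib_right square_integrable_mult Bochner_Integration.integral_add)
  show "inner (a *\<^sub>R f) g = a * inner f g"
    by transfer (simp add: mult.assoc)
  show "0 \<le> inner f f"
    by transfer simp
  show "inner f f = 0 \<longleftrightarrow> f = 0"
  proof (transfer, clarify)
    fix f :: "'a \<Rightarrow> real"
    assume f: "square_integrable f"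
    then have "(LINT x|lebesgue. f x * f x) = 0 \<longleftrightarrow> (AE x in lebesgue. f x * f x = 0)"
      by (intro integral_nonneg_eq_0_iff_AE square_integrable_mult) auto
    then show "(LINT x|lebesgue. f x * f x) = 0 \<longleftrightarrow>
        square_integrable f \<and> square_integrable (\<lambda>x. 0) \<and> (AE x in lebesgue. f x = 0)"
      using f by (simp add: square_integrable_zero)
  qed
  show "norm f = sqrt (inner f f)"
    by (simp add: norm_L2_def)
next
  fix U :: "'a L2 set"
  show "open U \<longleftrightarrow> (\<forall>x\<in>U. eventually (\<lambda>(x', y). x' = x \<longrightarrow> y \<in> U) uniformity)"
    by (simp add: open_L2_def)
qed

end

text \<open>
  A subset \<open>\<Omega>\<close> of the underlying Euclidean space cannot be a parameter of a type. The space of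
  square-integrable functions on \<open>\<Omega>\<close> is therefore rendered, via extension by zero, as the
  subspace of those classes on the whole space that vanish almost everywhere off \<open>\<Omega>\<close>.
  The lemmas below show that this is the usual space: its elements are exactly the classes of
  extensions by zero of square-integrable functions on \<open>\<Omega>\<close>, with the inner product of \<open>\<Omega>\<close>.
\<close>

definition L2_on :: "'a::euclidean_space set \<Rightarrow> 'a L2 set" where
  "L2_on \<Omega> = {f. AE x in lebesgue. x \<notin> \<Omega> \<longrightarrow> rep_L2 f x = 0}"

lemma rep_L2_square_integrable: "square_integrable (rep_L2 f)"
  using Quotient3_rep_reflp[OF Quotient3_L2] by blast

lemma abs_L2_rep_L2: "abs_L2 (rep_L2 f) = f"
  by (rule Quotient3_abs_rep[OF Quotient3_L2])

lemma rep_L2_abs_L2: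
  assumes "square_integrable f"
  shows "AE x in lebesgue. rep_L2 (abs_L2 f) x = f x"
  using rep_abs_rsp_left[OF Quotient3_L2, of f f] assms by simp

lemma abs_L2_eqI:
  assumes "square_integrable f" "square_integrable g" "AE x in lebesgue. f x = g x"
  shows "abs_L2 f = abs_L2 g"
  using Quotient3_rel_abs[OF Quotient3_L2, of f g] assms by simp

lemma abs_L2_in_L2_on:
  assumes "\<Omega> \<in> sets lebesgue" "f \<in> borel_measurable (lebesgue_on \<Omega>)"
    "integrable (lebesgue_on \<Omega>) (\<lambda>x. (f x)\<^sup>2)"
  shows "square_integrable (\<lambda>x. if x \<in> \<Omega> then f x else 0)"
    and "abs_L2 (\<lambda>x. if x \<in> \<Omega> then f x else 0) \<in> L2_on \<Omega>"
proof -
  have eq: "(\<lambda>x. (if x \<in> \<Omega> then f x else 0)\<^sup>2) = (\<lambda>x. if x \<in> \<Omega> then (f x)\<^sup>2 else 0)"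
    by auto
  show sq: "square_integrable (\<lambda>x. if x \<in> \<Omega> then f x else 0)"
    unfolding square_integrable_def eq
    using assms by (simp add: borel_measurable_if Lebesgue_Measure.integrable_restrict_UNIV)
  show "abs_L2 (\<lambda>x. if x \<in> \<Omega> then f x else 0) \<in> L2_on \<Omega>"
    unfolding L2_on_def using rep_L2_abs_L2[OF sq] by auto
qed

lemma L2_on_restrict:
  assumes "\<Omega> \<in> sets lebesgue" "f \<in> L2_on \<Omega>"
  shows "rep_L2 f \<in> borel_measurable (lebesgue_on \<Omega>)"
    and "integrable (lebesgue_on \<Omega>) (\<lambda>x. (rep_L2 f x)\<^sup>2)"
    and "abs_L2 (\<lambda>x. if x \<in> \<Omega> then rep_L2 f x else 0) = f"
proof -
  note sq = rep_L2_square_integrable[of f]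
  show meas: "rep_L2 f \<in> borel_measurable (lebesgue_on \<Omega>)"
    using sq unfolding square_integrable_def by (auto intro: measurable_restrict_space1)
  show int: "integrable (lebesgue_on \<Omega>) (\<lambda>x. (rep_L2 f x)\<^sup>2)"
    using sq assms(1) integrable_restrict_space[of \<Omega> lebesgue "\<lambda>x. (rep_L2 f x)\<^sup>2"]
      integrable_mult_indicator[of \<Omega> lebesgue "\<lambda>x. (rep_L2 f x)\<^sup>2"]
    unfolding square_integrable_def by auto
  have "AE x in lebesgue. (if x \<in> \<Omega> then rep_L2 f x else 0) = rep_L2 f x"
    using assms(2) unfolding L2_on_def by auto
  then show "abs_L2 (\<lambda>x. if x \<in> \<Omega> then rep_L2 f x else 0) = f"
    using abs_L2_eqI[OF abs_L2_in_L2_on(1)[OF assms(1) meas int] sq] abs_L2_rep_L2[of f] by simp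
qed

lemma inner_L2_on:
  assumes "\<Omega> \<in> sets lebesgue" "f \<in> L2_on \<Omega>"
  shows "inner f g = (LINT x|lebesgue_on \<Omega>. rep_L2 f x * rep_L2 g x)"
proof -
  have m: "rep_L2 f \<in> borel_measurable lebesgue" "rep_L2 g \<in> borel_measurable lebesgue"
    using rep_L2_square_integrable unfolding square_integrable_def by auto
  have "inner f g = (LINT x|lebesgue. rep_L2 f x * rep_L2 g x)"
    by (simp add: inner_L2.rep_eq)
  also have "\<dots> = (LINT x|lebesgue. indicator \<Omega> x *\<^sub>R (rep_L2 f x * rep_L2 g x))"
  proof (rule integral_cong_AE)
    show "AE x in lebesgue. rep_L2 f x * rep_L2 g x = indicator \<Omega> x *\<^sub>R (rep_L2 f x * rep_L2 g x)"
      using assms(2) unfolding L2_on_def by (auto simp: indicator_def)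
  qed (use m assms(1) in measurable)
  also have "\<dots> = (LINT x|lebesgue_on \<Omega>. rep_L2 f x * rep_L2 g x)"
    using assms(1) by (subst integral_restrict_space) auto
  finally show ?thesis .
qed

lemma subspace_L2_on: "subspace (L2_on \<Omega>)"
proof (rule subspaceI)
  show "0 \<in> L2_on \<Omega>"
    using rep_L2_abs_L2[OF square_integrable_zero]
    unfolding L2_on_def zero_L2_def by auto
next
  fix f g :: "'a L2"
  assume fg: "f \<in> L2_on \<Omega>" "g \<in> L2_on \<Omega>"
  have "AE x in lebesgue. rep_L2 (f + g) x = rep_L2 f x + rep_L2 g x"
    using rep_L2_abs_L2[OF square_integrable_add[OF rep_L2_square_integrable rep_L2_square_integrable]]
    by (simp add: plus_L2_def)
  then show "f + g \<in> L2_on \<Omega>"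
    using fg unfolding L2_on_def by auto
next
  fix c and f :: "'a L2"
  assume f: "f \<in> L2_on \<Omega>"
  have "AE x in lebesgue. rep_L2 (c *\<^sub>R f) x = c * rep_L2 f x"
    using rep_L2_abs_L2[OF square_integrable_scale[OF rep_L2_square_integrable]]
    by (simp add: scaleR_L2_def)
  then show "c *\<^sub>R f \<in> L2_on \<Omega>"
    using f unfolding L2_on_def by auto
qed


section \<open>Derivatives and covering constants on a subspace\<close>

text \<open>
  In the following notions \<open>H\<close> is a linear subspace, regarded as a Hilbert space in its own right,
  and only the restriction of \<open>F\<close> to \<open>H\<close> is relevant.
\<close>

definition has_frechet_derivative_on ::
  "'h::real_inner set \<Rightarrow> ('h \<Rightarrow> 'h) \<Rightarrow> 'h \<Rightarrow> ('h \<Rightarrow> 'h) \<Rightarrow> bool" where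
  "has_frechet_derivative_on H F x A \<longleftrightarrow>
     A ` H \<subseteq> H \<and>
     (\<forall>u\<in>H. \<forall>v\<in>H. A (u + v) = A u + A v) \<and>
     (\<forall>c. \<forall>u\<in>H. A (c *\<^sub>R u) = c *\<^sub>R A u) \<and>
     (\<exists>C. \<forall>u\<in>H. norm (A u) \<le> C * norm u) \<and>
     ((\<lambda>u. norm (F u - F x - A (u - x)) / norm (u - x)) \<longlongrightarrow> 0) (at x within H)"

definition frechet_differentiable_on ::
  "'h::real_inner set \<Rightarrow> ('h \<Rightarrow> 'h) \<Rightarrow> 'h \<Rightarrow> bool" where
  "frechet_differentiable_on H F x \<longleftrightarrow> (\<exists>A. has_frechet_derivative_on H F x A)"

text \<open>The values of the following operator at points of \<open>H\<close> do not depend on the choice made.\<close>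

definition frechet_derivative_on ::
  "'h::real_inner set \<Rightarrow> ('h \<Rightarrow> 'h) \<Rightarrow> 'h \<Rightarrow> 'h \<Rightarrow> 'h" where
  "frechet_derivative_on H F x = (SOME A. has_frechet_derivative_on H F x A)"

definition adjoint_on :: "'h::real_inner set \<Rightarrow> ('h \<Rightarrow> 'h) \<Rightarrow> 'h \<Rightarrow> 'h" where
  "adjoint_on H A g = (THE z. z \<in> H \<and> (\<forall>f\<in>H. inner (A f) g = inner f z))"

definition coderivative_on :: "'h::real_inner set \<Rightarrow> ('h \<Rightarrow> 'h) \<Rightarrow> 'h \<Rightarrow> 'h \<Rightarrow> 'h set" where
  "coderivative_on H F x y =
     {z\<in>H. Limsup (at x within H)
        (\<lambda>u. ereal ((inner z (u - x) - inner y (F u - F x)) /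
                    (norm (u - x) + norm (F u - F x)))) \<le> 0}"

definition mordukhovich_differentiable_on ::
  "'h::real_inner set \<Rightarrow> ('h \<Rightarrow> 'h) \<Rightarrow> 'h \<Rightarrow> bool" where
  "mordukhovich_differentiable_on H F x \<longleftrightarrow> (\<forall>y\<in>H. coderivative_on H F x y \<noteq> {})"

definition covering_constant_on ::
  "'h::real_inner set \<Rightarrow> ('h \<Rightarrow> 'h) \<Rightarrow> 'h \<Rightarrow> 'h \<Rightarrow> ereal" where
  "covering_constant_on H F x0 y0 =
     (SUP \<eta>\<in>{0::real<..}.
        Inf {ereal (norm z) | z x w.
              z \<in> coderivative_on H F x w \<and> x \<in> H \<and> x \<in> cball x0 \<eta> \<and> F x \<in> cball y0 \<eta> \<and>
              w \<in> H \<and> norm w = 1})"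

definition orthonormal_basis_on :: "'h::real_inner set \<Rightarrow> (nat \<Rightarrow> 'h) \<Rightarrow> bool" where
  "orthonormal_basis_on H \<phi> \<longleftrightarrow>
     (\<forall>i j. inner (\<phi> i) (\<phi> j) = (if i = j then 1 else 0)) \<and>
     closure (span (range \<phi>)) = H"


section \<open>Hilbert-Schmidt integral operators\<close>

definition square_integrable_kernel ::
  "'a::euclidean_space set \<Rightarrow> ('a \<Rightarrow> 'a \<Rightarrow> real) \<Rightarrow> bool" where
  "square_integrable_kernel \<Omega> k \<longleftrightarrow>
     (\<lambda>(s, t). k s t) \<in> borel_measurable (lebesgue_on (\<Omega> \<times> \<Omega>)) \<and>
     integrable (lebesgue_on (\<Omega> \<times> \<Omega>)) (\<lambda>(s, t). (k s t)\<^sup>2)"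

definition integral_operator ::
  "'a::euclidean_space set \<Rightarrow> ('a \<Rightarrow> 'a \<Rightarrow> real) \<Rightarrow> 'a L2 \<Rightarrow> 'a L2" where
  "integral_operator \<Omega> k f =
     abs_L2 (\<lambda>s. if s \<in> \<Omega> then LINT t|lebesgue_on \<Omega>. k s t * rep_L2 f t else 0)"

definition kernel_coeff ::
  "'a::euclidean_space set \<Rightarrow> ('a \<Rightarrow> 'a \<Rightarrow> real) \<Rightarrow> (nat \<Rightarrow> 'a L2) \<Rightarrow> nat \<Rightarrow> nat \<Rightarrow> real" where
  "kernel_coeff \<Omega> k \<phi> i j =
     (LINT (s, t)|lebesgue_on (\<Omega> \<times> \<Omega>). k s t * rep_L2 (\<phi> i) s * rep_L2 (\<phi> j) t)"

end

theory Submission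
  imports Defs
begin

text \<open>
  A bounded linear \<open>T\<close> is its own derivative, and its coderivative is the adjoint: along a ray
  \<open>u = x + t (z - S y)\<close>, with \<open>S\<close> the adjoint of \<open>T\<close>, the difference quotient defining the
  coderivative is a nonnegative constant that vanishes only for \<open>z = S y\<close>. By Fubini, the adjoint
  of the integral operator with kernel \<open>k\<close> is the one with the transposed kernel, so both series
  come from expanding first \<open>T f\<close> and then \<open>f\<close> in the basis. Bessel's inequality applied to the
  sections of the kernel bounds \<open>\<Sum>i. \<parallel>S \<phi>\<^sub>i\<parallel>\<^sup>2\<close> by the squared norm of the kernel;
  hence \<open>S \<phi>\<^sub>i \<longlonglongrightarrow> 0\<close> for the unit vectors \<open>\<phi>\<^sub>i\<close>, and the covering constant is zero.
\<close>

section \<open>Orthonormal expansions\<close>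

lemma inner_sum_orthonormal:
  fixes \<phi> :: "nat \<Rightarrow> 'h::real_inner"
  assumes "\<forall>i j. inner (\<phi> i) (\<phi> j) = (if i = j then 1 else 0)" and "finite I"
  shows "inner (\<Sum>i\<in>I. a i *\<^sub>R \<phi> i) (\<phi> j) = (if j \<in> I then a j else 0)"
  using \<open>finite I\<close> by (simp add: inner_sum_left assms(1)[rule_format] if_distrib sum.delta cong: if_cong)

text \<open>For the partial sum \<open>p\<close>, both \<open>inner f p\<close> and
  \<open>inner p p\<close> equal the sum of squared coefficients. Expanding the nonnegative squared
  norm of \<open>f - p\<close> therefore leaves exactly the claimed difference.\<close>

lemma bessel_inequality:
  fixes \<phi> :: "nat \<Rightarrow> 'h::real_inner"
  assumes on: "\<forall>i j. inner (\<phi> i) (\<phi> j) = (if i = j then 1 else 0)"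
  shows "(\<Sum>i<n. (inner f (\<phi> i))\<^sup>2) \<le> (norm f)\<^sup>2"
proof -
  define p where "p = (\<Sum>i<n. inner f (\<phi> i) *\<^sub>R \<phi> i)"
  have fp: "inner f p = (\<Sum>i<n. (inner f (\<phi> i))\<^sup>2)"
    unfolding p_def by (simp add: inner_sum_right power2_eq_square)
  have "inner p p = (\<Sum>i<n. inner f (\<phi> i) * inner p (\<phi> i))"
    by (subst (2) p_def) (simp add: inner_sum_right)
  also have "\<dots> = (\<Sum>i<n. (inner f (\<phi> i))\<^sup>2)"
    unfolding p_def by (rule sum.cong) (simp_all add: inner_sum_orthonormal[OF on] power2_eq_square)
  finally have pp: "inner p p = (\<Sum>i<n. (inner f (\<phi> i))\<^sup>2)" .
  have "0 \<le> inner (f - p) (f - p)" by simp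
  also have "\<dots> = inner f f - 2 * inner f p + inner p p"
    by (simp add: inner_diff_left inner_diff_right inner_commute)
  finally show ?thesis
    unfolding fp pp by (simp add: dot_square_norm)
qed

text \<open>Links density of the span to partial sums: an approximant uses only finitely many basis
  vectors, so it competes with every sufficiently long partial sum.\<close>

lemma span_range_obtain_finite:
  fixes \<phi> :: "nat \<Rightarrow> 'h::real_vector"
  assumes "y \<in> span (range \<phi>)"
  obtains N where "y \<in> span (\<phi> ` {..<N})"
proof -
  obtain t where t: "finite t" "t \<subseteq> range \<phi>" "y \<in> span t"
  proof -
    obtain t r where "finite t" "t \<subseteq> range \<phi>" "y = (\<Sum>a\<in>t. r a *\<^sub>R a)"
      using assms unfolding span_explicit by blast
    then show thesis by (intro that[of t]) (auto intro: span_sum span_scale span_base)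
  qed
  obtain I where I: "finite I" "t = \<phi> ` I"
    using finite_subset_image[OF t(1,2)] by auto
  obtain N where "I \<subseteq> {..<N}"
    using finite_nat_bounded[OF I(1)] by auto
  then have "span t \<subseteq> span (\<phi> ` {..<N})"
    using I(2) by (intro span_mono image_mono) auto
  then show ?thesis using that t(3) by blast
qed

text \<open>The partial sums are best approximations, so density of the span suffices and completeness
  of \<open>H\<close> is not needed.\<close>

lemma orthonormal_expansion:
  fixes \<phi> :: "nat \<Rightarrow> 'h::real_inner"
  assumes "orthonormal_basis_on H \<phi>" and "f \<in> H"
  shows "(\<lambda>i. inner f (\<phi> i) *\<^sub>R \<phi> i) sums f"
proof -
  have on: "\<forall>i j. inner (\<phi> i) (\<phi> j) = (if i = j then 1 else 0)"
    and cl: "f \<in> closure (span (range \<phi>))"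
    using assms by (auto simp: orthonormal_basis_on_def)
  define P where "P n = (\<Sum>i<n. inner f (\<phi> i) *\<^sub>R \<phi> i)" for n
  have best: "norm (f - P n) \<le> norm (f - y)" if "y \<in> span (\<phi> ` {..<n})" for y n
  proof -
    have "orthogonal (f - P n) (\<phi> i)" if "i < n" for i
      using that by (simp add: orthogonal_def inner_diff_left P_def inner_sum_orthonormal[OF on])
    moreover have "P n - y \<in> span (\<phi> ` {..<n})"
      unfolding P_def by (intro span_diff[OF _ that] span_sum span_scale span_base) auto
    ultimately have "orthogonal (f - P n) (P n - y)"
      using orthogonal_to_span[of "P n - y" "\<phi> ` {..<n}" "f - P n"] by auto
    \<comment> \<open>The argument on the left is \<open>f - y\<close>, split into a part orthogonal
      to the span and a part inside it.\<close>
    then have "(norm ((f - P n) + (P n - y)))\<^sup>2 = (norm (f - P n))\<^sup>2 + (norm (P n - y))\<^sup>2"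
      by (rule norm_add_Pythagorean)
    then have "(norm (f - P n))\<^sup>2 \<le> (norm (f - y))\<^sup>2" by simp
    then show ?thesis by (rule power2_le_imp_le) simp
  qed
  have "P \<longlonglongrightarrow> f"
  proof (rule LIMSEQ_I)
    fix e :: real assume "0 < e"
    then obtain y where y: "y \<in> span (range \<phi>)" "dist y f < e"
      using cl closure_approachable by blast
    obtain N where N: "y \<in> span (\<phi> ` {..<N})"
      using span_range_obtain_finite[OF y(1)] .
    have "norm (P n - f) < e" if "N \<le> n" for n
    proof -
      have "span (\<phi> ` {..<N}) \<subseteq> span (\<phi> ` {..<n})"
        using that by (intro span_mono image_mono) auto
      with N have "y \<in> span (\<phi> ` {..<n})" by blast
      then have "norm (f - P n) \<le> norm (f - y)" by (rule best)
      then show ?thesis using y(2) by (simp add: dist_norm norm_minus_commute)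
    qed
    then show "\<exists>N. \<forall>n\<ge>N. norm (P n - f) < e" by blast
  qed
  then show ?thesis by (simp add: sums_def P_def[abs_def])
qed

lemma orthonormal_basis_on_mem:
  "orthonormal_basis_on H \<phi> \<Longrightarrow> \<phi> i \<in> H"
  unfolding orthonormal_basis_on_def
  by (metis closure_subset rangeI span_base subsetD)

text \<open>Pairing the expansion of \<open>f\<close> termwise with \<open>S (\<phi> i)\<close>,
  which is legitimate by continuity, evaluates the inner series as the coefficient
  \<open>inner (T f) (\<phi> i)\<close>; the outer series is then the expansion of
  \<open>T f\<close>. The roles of \<open>T\<close> and \<open>S\<close> are symmetric, so one
  argument serves both series of the theorem.\<close>

lemma adjoint_sums:
  fixes T :: "'h::real_inner \<Rightarrow> 'h"
  assumes B: "orthonormal_basis_on H \<phi>"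
    and adj: "\<And>f g. inner (T f) g = inner f (S g)"
    and SH: "\<And>g. S g \<in> H" and TH: "\<And>f. T f \<in> H"
    and f: "f \<in> H"
  shows "summable (\<lambda>j. inner (T (\<phi> j)) (\<phi> i) * inner f (\<phi> j))"
    and "(\<lambda>i. (\<Sum>j. inner (T (\<phi> j)) (\<phi> i) * inner f (\<phi> j)) *\<^sub>R \<phi> i) sums T f"
proof -
  have row: "(\<lambda>j. inner (T (\<phi> j)) (\<phi> i) * inner f (\<phi> j)) sums inner (T f) (\<phi> i)" for i
    using bounded_linear.sums[OF bounded_linear_inner_left[of "S (\<phi> i)"] orthonormal_expansion[OF B f]]
    by (simp add: adj mult.commute)
  show "summable (\<lambda>j. inner (T (\<phi> j)) (\<phi> i) * inner f (\<phi> j))"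
    using row sums_summable by blast
  show "(\<lambda>i. (\<Sum>j. inner (T (\<phi> j)) (\<phi> i) * inner f (\<phi> j)) *\<^sub>R \<phi> i) sums T f"
    using orthonormal_expansion[OF B TH, of f] sums_unique[OF row] by simp
qed

text \<open>Linearity comes from the adjoint relation alone: the two sides of each identity have the
  same inner product with every vector. This avoids splitting integrals, which would require
  integrability to be checked.\<close>

lemma bounded_linear_of_adjoint:
  fixes T :: "'h::real_inner \<Rightarrow> 'h"
  assumes adj: "\<And>f g. inner (T f) g = inner f (S g)"
    and bd: "\<And>f. norm (T f) \<le> C * norm f"
  shows "bounded_linear T"
proof (rule bounded_linear_intro)
  fix f g r
  have "inner (T (f + g)) v = inner (T f + T g) v" for v
    by (simp add: adj inner_add_left)
  then show "T (f + g) = T f + T g"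
    by (metis vector_eq_rdot)
  have "inner (T (r *\<^sub>R f)) v = inner (r *\<^sub>R T f) v" for v
    by (simp add: adj)
  then show "T (r *\<^sub>R f) = r *\<^sub>R T f"
    by (metis vector_eq_rdot)
  show "norm (T f) \<le> norm f * C"
    using bd by (simp add: mult.commute)
qed

section \<open>Bounded linear operators on a subspace\<close>

text \<open>A property that holds near \<open>x\<close> within \<open>H\<close> can be tested in any
  chosen direction of \<open>H\<close>. Quotients that are constant along rays are evaluated with
  it.\<close>

lemma eventually_at_within_ray:
  fixes x :: "'h::real_normed_vector"
  assumes "subspace H" and "x \<in> H" and "v \<in> H" and "v \<noteq> 0"
    and "eventually P (at x within H)"
  obtains t :: real where "0 < t" and "P (x + t *\<^sub>R v)"
proof -
  obtain d where d: "0 < d" "\<And>u. u \<in> H \<Longrightarrow> u \<noteq> x \<Longrightarrow> dist u x < d \<Longrightarrow> P u"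
    using assms(5) unfolding eventually_at by blast
  \<comment> \<open>This makes the displacement \<open>t *\<^sub>R v\<close> have norm
    \<open>d / 2\<close>, and it is nonzero, so the punctured neighbourhood is respected.\<close>
  define t where "t = d / (2 * norm v)"
  have t: "0 < t" "norm (t *\<^sub>R v) < d"
    using d(1) assms(4) by (auto simp: t_def)
  have "P (x + t *\<^sub>R v)"
    using assms t by (intro d(2)) (auto simp: dist_norm intro: subspace_add subspace_scale)
  with t(1) show ?thesis by (rule that)
qed

lemma has_frechet_derivative_on_bounded_linear:
  assumes "bounded_linear T" and "T ` H \<subseteq> H"
  shows "has_frechet_derivative_on H T x T"
proof -
  interpret bounded_linear T by fact
  show ?thesis
    unfolding has_frechet_derivative_on_def
    using assms(2) nonneg_bounded by (auto simp: add scaleR diff mult.commute)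
qed

text \<open>Justifies reading \<open>frechet_derivative_on\<close>, which is an arbitrary choice, as
  the derivative at points of \<open>H\<close>.\<close>

lemma has_frechet_derivative_on_unique:
  assumes H: "subspace H" and x: "x \<in> H" and u: "u \<in> H"
    and A: "has_frechet_derivative_on H F x A" and B: "has_frechet_derivative_on H F x B"
  shows "A u = B u"
proof (rule ccontr)
  assume ne: "A u \<noteq> B u"
  have scale: "A (c *\<^sub>R u) = c *\<^sub>R A u" "B (c *\<^sub>R u) = c *\<^sub>R B u" for c
    using A B u unfolding has_frechet_derivative_on_def by auto
  have u0: "u \<noteq> 0" using ne scale[of 0] by auto
  \<comment> \<open>By homogeneity, \<open>e\<close> is the relative difference of \<open>A\<close>
    and \<open>B\<close> at every positive multiple of \<open>u\<close>. The triangle inequality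
    bounds it by the sum of the two error quotients, which tends to 0.\<close>
  define e where "e = norm (A u - B u) / norm u"
  have e: "0 < e" using ne u0 by (simp add: e_def)
  have "((\<lambda>v. norm (F v - F x - A (v - x)) / norm (v - x) + norm (F v - F x - B (v - x)) / norm (v - x))
      \<longlongrightarrow> 0 + 0) (at x within H)"
    using A B unfolding has_frechet_derivative_on_def by (intro tendsto_add) auto
  then have "\<forall>\<^sub>F v in at x within H. norm (F v - F x - A (v - x)) / norm (v - x)
      + norm (F v - F x - B (v - x)) / norm (v - x) < e"
    using e by (intro order_tendstoD(2)) auto
  from eventually_at_within_ray[OF H x u u0 this] obtain t where t: "0 < t"
    and "norm (F (x + t *\<^sub>R u) - F x - A (t *\<^sub>R u)) / norm (t *\<^sub>R u)
      + norm (F (x + t *\<^sub>R u) - F x - B (t *\<^sub>R u)) / norm (t *\<^sub>R u) < e"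
    by auto
  then have "norm (F (x + t *\<^sub>R u) - F x - A (t *\<^sub>R u))
      + norm (F (x + t *\<^sub>R u) - F x - B (t *\<^sub>R u)) < e * norm (t *\<^sub>R u)"
    using u0 by (simp add: field_simps)
  also have "e * norm (t *\<^sub>R u) = norm (A (t *\<^sub>R u) - B (t *\<^sub>R u))"
    using t u0 by (simp add: scale e_def flip: scaleR_diff_right)
  also have "\<dots> \<le> norm (F (x + t *\<^sub>R u) - F x - A (t *\<^sub>R u)) + norm (F (x + t *\<^sub>R u) - F x - B (t *\<^sub>R u))"
    using norm_triangle_ineq4[of "F (x + t *\<^sub>R u) - F x - B (t *\<^sub>R u)" "F (x + t *\<^sub>R u) - F x - A (t *\<^sub>R u)"]
    by simp
  finally show False by simp
qed

lemma frechet_derivative_on_bounded_linear: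
  assumes "subspace H" and "bounded_linear T" and "T ` H \<subseteq> H" and "x \<in> H" and "u \<in> H"
  shows "frechet_derivative_on H T x u = T u"
proof -
  note D = has_frechet_derivative_on_bounded_linear[OF assms(2,3), of x]
  have "has_frechet_derivative_on H T x (frechet_derivative_on H T x)"
    unfolding frechet_derivative_on_def by (rule someI[of _ T]) (rule D)
  from has_frechet_derivative_on_unique[OF assms(1,4,5) this D] show ?thesis .
qed

lemma adjoint_on_eqI:
  assumes "subspace H" and "z \<in> H" and "\<And>f. f \<in> H \<Longrightarrow> inner (A f) g = inner f z"
  shows "adjoint_on H A g = z"
  unfolding adjoint_on_def
proof (rule the_equality)
  fix w assume w: "w \<in> H \<and> (\<forall>f\<in>H. inner (A f) g = inner f w)"
  have "w - z \<in> H" using w assms by (auto intro: subspace_diff)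
  \<comment> \<open>The vector \<open>w - z\<close> is itself an admissible test vector, since
    \<open>H\<close> is a subspace.\<close>
  then have "inner (w - z) (w - z) = 0"
    using w assms(3) by (metis inner_diff_right right_minus_eq)
  then show "w = z" by simp
qed (use assms in auto)

lemma coderivative_on_bounded_linear:
  assumes H: "subspace H" and T: "bounded_linear T" and S: "S y \<in> H"
    and adj: "\<And>f. f \<in> H \<Longrightarrow> inner (T f) y = inner f (S y)" and x: "x \<in> H"
  shows "coderivative_on H T x y = {S y}"
proof -
  interpret bounded_linear T by fact
  \<comment> \<open>The numerator is linear in \<open>u - x\<close>. It vanishes identically for
    \<open>z = S y\<close>, and any other \<open>z\<close> is refuted by moving in the direction
    \<open>z - S y\<close>.\<close>
  have quot: "inner z (u - x) - inner y (T u - T x) = inner (z - S y) (u - x)" if "u \<in> H" for z u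
    using adj[of "u - x"] that x H by (simp add: subspace_diff inner_diff inner_commute flip: diff)
  have "S y \<in> coderivative_on H T x y"
  proof -
    have "\<forall>\<^sub>F u in at x within H. ereal ((inner (S y) (u - x) - inner y (T u - T x)) /
        (norm (u - x) + norm (T u - T x))) \<le> 0"
      unfolding eventually_at by (intro exI[of _ 1]) (auto simp: quot)
    then show ?thesis
      unfolding coderivative_on_def using S by (auto dest: Limsup_bounded simp del: ereal_less_eq)
  qed
  moreover have "z = S y" if z: "z \<in> coderivative_on H T x y" for z
  proof (rule ccontr)
    assume "z \<noteq> S y"
    define d where "d = z - S y"
    have d0: "d \<noteq> 0" and dH: "d \<in> H"
      using \<open>z \<noteq> S y\<close> z S H by (auto simp: d_def coderivative_on_def subspace_diff)
    \<comment> \<open>The value of the difference quotient at \<open>x + t *\<^sub>R d\<close> for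
      every \<open>t > 0\<close>: numerator and denominator both scale by \<open>t\<close>. A limsup
      at most 0 would force a smaller value somewhere on the ray.\<close>
    define e where "e = inner d d / (norm d + norm (T d))"
    have "0 < norm d + norm (T d)" using d0 by (simp add: add_pos_nonneg)
    then have e: "0 < e" using d0 by (simp add: e_def)
    have "Limsup (at x within H) (\<lambda>u. ereal ((inner z (u - x) - inner y (T u - T x)) /
        (norm (u - x) + norm (T u - T x)))) < ereal e"
      using z e unfolding coderivative_on_def by (auto intro: le_less_trans)
    from eventually_at_within_ray[OF H x dH d0 Limsup_lessD[OF this]]
    obtain t where t: "0 < t" and lt: "(inner z (x + t *\<^sub>R d - x) - inner y (T (x + t *\<^sub>R d) - T x)) /
        (norm (x + t *\<^sub>R d - x) + norm (T (x + t *\<^sub>R d) - T x)) < e"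
      by auto
    have "(inner z (x + t *\<^sub>R d - x) - inner y (T (x + t *\<^sub>R d) - T x)) = t * inner d d"
      using quot[of "x + t *\<^sub>R d" z] x dH H by (simp add: subspace_add subspace_scale d_def)
    moreover have "norm (x + t *\<^sub>R d - x) + norm (T (x + t *\<^sub>R d) - T x) = t * (norm d + norm (T d))"
      using t by (simp add: add scaleR distrib_left)
    ultimately show False using lt t by (simp add: e_def)
  qed
  ultimately show ?thesis by blast
qed

lemma covering_constant_on_eq_0:
  assumes H: "subspace H" and T: "bounded_linear T" and S: "\<And>y. y \<in> H \<Longrightarrow> S y \<in> H"
    and adj: "\<And>f y. f \<in> H \<Longrightarrow> y \<in> H \<Longrightarrow> inner (T f) y = inner f (S y)" and x: "x \<in> H"
    and w: "\<And>i::nat. w i \<in> H" "\<And>i. norm (w i) = 1" "(\<lambda>i. norm (S (w i))) \<longlonglongrightarrow> 0"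
  shows "covering_constant_on H T x (T x) = 0"
proof -
  have "Inf {ereal (norm z) | z u v. z \<in> coderivative_on H T u v \<and> u \<in> H \<and> u \<in> cball x \<eta> \<and>
      T u \<in> cball (T x) \<eta> \<and> v \<in> H \<and> norm v = 1} = 0" (is "Inf ?A = 0") if "0 < \<eta>" for \<eta>
  proof (rule antisym)
    have "ereal (norm (S (w i))) \<in> ?A" for i
    proof -
      \<comment> \<open>The base point can stay at \<open>x\<close>, which lies in every ball, so
        only the unit vector varies. The infimum is thus 0 for each radius, before the supremum is
        taken.\<close>
      have "S (w i) \<in> coderivative_on H T x (w i)"
        using coderivative_on_bounded_linear[OF H T, of S "w i" x] S adj x w by auto
      then show ?thesis using x w that by fastforce
    qed
    then have le: "Inf ?A \<le> ereal (norm (S (w i)))" for i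
      by (rule Inf_lower)
    have "(\<lambda>i. ereal (norm (S (w i)))) \<longlonglongrightarrow> ereal 0"
      using w(3) by simp
    then show "Inf ?A \<le> 0"
      unfolding zero_ereal_def by (rule LIMSEQ_le_const) (use le in blast)
    show "0 \<le> Inf ?A" by (rule Inf_greatest) auto
  qed
  then show ?thesis
    unfolding covering_constant_on_def by simp
qed


section \<open>Operators with square-integrable kernels\<close>

text \<open>
  Lebesgue measure on the product space strictly extends the product of the Lebesgue measures, so
  Fubini is applied to Borel representatives of the kernel and of the functions.
\<close>

lemma square_integrable_borel:
  assumes "f \<in> borel_measurable borel" and "integrable lborel (\<lambda>x. (f x)\<^sup>2)"
  shows "square_integrable f"
  using assms unfolding square_integrable_def
  by (auto intro: measurable_completion simp: integrable_completion)

text \<open>Measurability of \<open>f\<close> is inherited from \<open>g\<close> because Lebesgue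
  measure is complete.\<close>

lemma square_integrable_AE:
  assumes "square_integrable g" and "AE x in lebesgue. g x = f x"
  shows "square_integrable f"
proof -
  have f: "f \<in> borel_measurable lebesgue"
    using assms borel_measurable_AE unfolding square_integrable_def by blast
  have "integrable lebesgue (\<lambda>x. (f x)\<^sup>2)"
    by (rule integrable_cong_AE_imp[of lebesgue "\<lambda>x. (g x)\<^sup>2"])
      (use assms f in \<open>auto simp: square_integrable_def\<close>)
  with f show ?thesis by (simp add: square_integrable_def)
qed

lemma square_integrable_obtain_borel:
  assumes "square_integrable g"
  obtains f where "f \<in> borel_measurable borel" "integrable lborel (\<lambda>x. (f x)\<^sup>2)"
    "AE x in lborel. g x = f x"
proof -
  obtain f where f: "f \<in> borel_measurable lborel" "AE x in lborel. g x = f x"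
    using assms completion_ex_borel_measurable_real[of g lborel] unfolding square_integrable_def by blast
  have "square_integrable f"
    using square_integrable_AE[OF assms AE_completion[OF f(2)]] .
  with f show ?thesis
    by (intro that[of f]) (auto simp: square_integrable_def integrable_completion)
qed

lemma L2_obtain_borel:
  obtains f where "f \<in> borel_measurable borel" "integrable lborel (\<lambda>x. (f x)\<^sup>2)" "v = abs_L2 f"
proof -
  obtain f where f: "f \<in> borel_measurable borel" "integrable lborel (\<lambda>x. (f x)\<^sup>2)"
    "AE x in lborel. rep_L2 v x = f x"
    using square_integrable_obtain_borel[OF rep_L2_square_integrable] .
  have "abs_L2 (rep_L2 v) = abs_L2 f"
    using f by (intro abs_L2_eqI rep_L2_square_integrable square_integrable_borel AE_completion)
  with f show ?thesis by (intro that[of f]) (simp_all add: abs_L2_rep_L2)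
qed

lemma inner_abs_L2:
  assumes "square_integrable f" and "square_integrable g"
  shows "inner (abs_L2 f) (abs_L2 g) = (LINT x|lebesgue. f x * g x)"
  unfolding inner_L2.rep_eq
proof (rule integral_cong_AE)
  show "AE x in lebesgue. rep_L2 (abs_L2 f) x * rep_L2 (abs_L2 g) x = f x * g x"
    using rep_L2_abs_L2[OF assms(1)] rep_L2_abs_L2[OF assms(2)] by eventually_elim simp
  show "(\<lambda>x. rep_L2 (abs_L2 f) x * rep_L2 (abs_L2 g) x) \<in> borel_measurable lebesgue"
    using rep_L2_square_integrable[of "abs_L2 f"] rep_L2_square_integrable[of "abs_L2 g"]
    unfolding square_integrable_def by (auto intro: borel_measurable_times)
  show "(\<lambda>x. f x * g x) \<in> borel_measurable lebesgue"
    using assms unfolding square_integrable_def by (auto intro: borel_measurable_times)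
qed

lemma inner_abs_L2_borel:
  assumes "f \<in> borel_measurable borel" "integrable lborel (\<lambda>x. (f x)\<^sup>2)"
    and "g \<in> borel_measurable borel" "integrable lborel (\<lambda>x. (g x)\<^sup>2)"
  shows "inner (abs_L2 f) (abs_L2 g) = (LINT x|lborel. f x * g x)"
proof -
  have "(\<lambda>x. f x * g x) \<in> borel_measurable lborel" using assms by simp
  from integral_completion[OF this] show ?thesis
    using inner_abs_L2[OF square_integrable_borel[OF assms(1,2)] square_integrable_borel[OF assms(3,4)]]
    by simp
qed

lemma norm_abs_L2_borel:
  assumes "f \<in> borel_measurable borel" "integrable lborel (\<lambda>x. (f x)\<^sup>2)"
  shows "(norm (abs_L2 f))\<^sup>2 = (LINT x|lborel. (f x)\<^sup>2)"
  unfolding power2_norm_eq_inner using inner_abs_L2_borel[OF assms assms] by (simp add: power2_eq_square)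

text \<open>The domain \<open>\<Omega>\<close> is absorbed into the kernel, which is later taken to
  vanish off \<open>\<Omega> \<times> \<Omega>\<close>. With the kernel as a function of pairs,
  transposition is composition with \<open>prod.swap\<close>.\<close>

definition kernel_operator :: "('a::euclidean_space \<times> 'a \<Rightarrow> real) \<Rightarrow> 'a L2 \<Rightarrow> 'a L2" where
  "kernel_operator K f = abs_L2 (\<lambda>s. LINT t|lebesgue. K (s, t) * rep_L2 f t)"

section \<open>Measurability and the Hilbert-Schmidt bound for Borel kernels\<close>

lemma borel_measurable_pair_lborel:
  fixes K :: "'a::euclidean_space \<times> 'b::euclidean_space \<Rightarrow> real"
  shows "K \<in> borel_measurable borel \<Longrightarrow> K \<in> borel_measurable (lborel \<Otimes>\<^sub>M lborel)"
  by (simp add: lborel_prod)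

lemma borel_measurable_section:
  fixes K :: "'a::euclidean_space \<times> 'b::euclidean_space \<Rightarrow> real"
  assumes "K \<in> borel_measurable borel"
  shows "(\<lambda>t. K (s, t)) \<in> borel_measurable borel"
  by (rule measurable_compose[OF _ assms]) simp

lemma borel_measurable_kernel_integral:
  fixes K :: "'a::euclidean_space \<times> 'b::euclidean_space \<Rightarrow> real"
  assumes "K \<in> borel_measurable borel" and "f \<in> borel_measurable borel"
  shows "(\<lambda>s. LINT t|lborel. K (s, t) * f t) \<in> borel_measurable borel"
proof -
  have K[measurable]: "K \<in> borel_measurable (lborel \<Otimes>\<^sub>M lborel)"
    using assms(1) by (rule borel_measurable_pair_lborel)
  have f[measurable]: "f \<in> borel_measurable lborel" using assms(2) by simp
  have "(\<lambda>s. LINT t|lborel. K (s, t) * f t) \<in> borel_measurable lborel"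
    by measurable
  then show ?thesis by simp
qed

lemma LINT_rep_L2_abs_L2:
  assumes "K \<in> borel_measurable borel"
    and "f \<in> borel_measurable borel" "integrable lborel (\<lambda>x. (f x)\<^sup>2)"
  shows "(LINT t|lebesgue. K t * rep_L2 (abs_L2 f) t) = (LINT t|lborel. K t * f t)"
proof -
  have "(LINT t|lebesgue. K t * rep_L2 (abs_L2 f) t) = (LINT t|lebesgue. K t * f t)"
  proof (rule integral_cong_AE)
    show "AE t in lebesgue. K t * rep_L2 (abs_L2 f) t = K t * f t"
      using rep_L2_abs_L2[OF square_integrable_borel[OF assms(2,3)]] by eventually_elim simp
    have "K \<in> borel_measurable lebesgue" "f \<in> borel_measurable lebesgue"
      using assms by (auto intro: measurable_completion)
    then show "(\<lambda>t. K t * rep_L2 (abs_L2 f) t) \<in> borel_measurable lebesgue"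
      "(\<lambda>t. K t * f t) \<in> borel_measurable lebesgue"
      using rep_L2_square_integrable[of "abs_L2 f"] unfolding square_integrable_def
      by (auto intro: borel_measurable_times)
  qed
  also have "\<dots> = (LINT t|lborel. K t * f t)"
    using assms by (intro integral_completion) simp
  finally show ?thesis .
qed

lemma kernel_operator_abs_L2:
  assumes "K \<in> borel_measurable borel"
    and "f \<in> borel_measurable borel" "integrable lborel (\<lambda>x. (f x)\<^sup>2)"
  shows "kernel_operator K (abs_L2 f) = abs_L2 (\<lambda>s. LINT t|lborel. K (s, t) * f t)"
  unfolding kernel_operator_def
    LINT_rep_L2_abs_L2[OF borel_measurable_section[OF assms(1)] assms(2,3)] ..

lemma AE_square_integrable_section:
  fixes K :: "'a::euclidean_space \<times> 'b::euclidean_space \<Rightarrow> real"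
  assumes "integrable lborel (\<lambda>p. (K p)\<^sup>2)"
  shows "AE s in lborel. integrable lborel (\<lambda>t. (K (s, t))\<^sup>2)"
  using assms lborel_pair.AE_integrable_fst'[of "\<lambda>p. (K p)\<^sup>2"] by (simp add: lborel_prod)

text \<open>Cauchy-Schwarz in \<open>t\<close> for each section of the kernel, followed by
  integration in \<open>s\<close>. The sections are square-integrable only for almost every
  \<open>s\<close>, so the pointwise bound is an almost-everywhere statement.\<close>

lemma kernel_integral_square_bound:
  fixes K :: "'a::euclidean_space \<times> 'b::euclidean_space \<Rightarrow> real"
  assumes K: "K \<in> borel_measurable borel" "integrable lborel (\<lambda>p. (K p)\<^sup>2)"
    and f: "f \<in> borel_measurable borel" "integrable lborel (\<lambda>x. (f x)\<^sup>2)"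
  shows "integrable lborel (\<lambda>s. (LINT t|lborel. K (s, t) * f t)\<^sup>2)" (is ?int)
    and "(LINT s|lborel. (LINT t|lborel. K (s, t) * f t)\<^sup>2)
      \<le> (LINT p|lborel. (K p)\<^sup>2) * (LINT t|lborel. (f t)\<^sup>2)" (is ?le)
proof -
  have int: "integrable lborel (\<lambda>s. (LINT t|lborel. (K (s, t))\<^sup>2) * (LINT t|lborel. (f t)\<^sup>2))"
    using K(2) lborel_pair.integrable_fst'[of "\<lambda>p. (K p)\<^sup>2"]
    by (intro integrable_mult_left) (simp add: lborel_prod)
  have bound: "AE s in lborel. (LINT t|lborel. K (s, t) * f t)\<^sup>2
      \<le> (LINT t|lborel. (K (s, t))\<^sup>2) * (LINT t|lborel. (f t)\<^sup>2)"
    using AE_square_integrable_section[OF K(2)]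
  proof eventually_elim
    case (elim s)
    note Ks = borel_measurable_section[OF K(1), of s] elim
    show ?case
      \<comment> \<open>The inequality for integrals is read off from the inner product space
        \<open>L2\<close>, with the section of \<open>K\<close> as one of its elements.\<close>
      using Cauchy_Schwarz_ineq[of "abs_L2 (\<lambda>t. K (s, t))" "abs_L2 f"]
      unfolding inner_abs_L2_borel[OF Ks f] inner_abs_L2_borel[OF Ks Ks] inner_abs_L2_borel[OF f f]
      by (simp add: power2_eq_square)
  qed
  show int': ?int
  proof (rule Bochner_Integration.integrable_bound[OF int])
    show "(\<lambda>s. (LINT t|lborel. K (s, t) * f t)\<^sup>2) \<in> borel_measurable lborel"
      using borel_measurable_kernel_integral[OF K(1) f(1)] by simp
    show "AE s in lborel. norm ((LINT t|lborel. K (s, t) * f t)\<^sup>2)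
        \<le> norm ((LINT t|lborel. (K (s, t))\<^sup>2) * (LINT t|lborel. (f t)\<^sup>2))"
      using bound by eventually_elim simp
  qed
  have "(LINT s|lborel. (LINT t|lborel. K (s, t) * f t)\<^sup>2)
      \<le> (LINT s|lborel. (LINT t|lborel. (K (s, t))\<^sup>2) * (LINT t|lborel. (f t)\<^sup>2))"
    by (rule integral_mono_AE[OF int' int bound])
  also have "\<dots> = (LINT p|lborel. (K p)\<^sup>2) * (LINT t|lborel. (f t)\<^sup>2)"
    using K(2) lborel_pair.integral_fst'[of "\<lambda>p. (K p)\<^sup>2"] by (simp add: lborel_prod)
  finally show ?le .
qed

lemma kernel_operator_norm_le:
  assumes K: "K \<in> borel_measurable borel" "integrable lborel (\<lambda>p. (K p)\<^sup>2)"
  shows "norm (kernel_operator K v) \<le> sqrt (LINT p|lborel. (K p)\<^sup>2) * norm v"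
proof -
  obtain f where f: "f \<in> borel_measurable borel" "integrable lborel (\<lambda>x. (f x)\<^sup>2)" "v = abs_L2 f"
    by (rule L2_obtain_borel)
  have "(norm (kernel_operator K v))\<^sup>2 \<le> (LINT p|lborel. (K p)\<^sup>2) * (norm v)\<^sup>2"
    using kernel_integral_square_bound[OF K f(1,2)] borel_measurable_kernel_integral[OF K(1) f(1)]
    by (simp add: f kernel_operator_abs_L2 K norm_abs_L2_borel)
  then have "(norm (kernel_operator K v))\<^sup>2 \<le> (sqrt (LINT p|lborel. (K p)\<^sup>2) * norm v)\<^sup>2"
    by (simp add: power_mult_distrib)
  then show ?thesis
    by (rule power2_le_imp_le) simp
qed

section \<open>Double integrals and the adjoint\<close>

lemma integrable_tensor_square:
  fixes f :: "'a::euclidean_space \<Rightarrow> real" and g :: "'b::euclidean_space \<Rightarrow> real"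
  assumes f: "f \<in> borel_measurable borel" "integrable lborel (\<lambda>x. (f x)\<^sup>2)"
    and g: "g \<in> borel_measurable borel" "integrable lborel (\<lambda>x. (g x)\<^sup>2)"
  shows "(\<lambda>p. g (fst p) * f (snd p)) \<in> borel_measurable borel"
    and "integrable lborel (\<lambda>p. (g (fst p) * f (snd p))\<^sup>2)"
proof -
  have [measurable]: "f \<in> borel_measurable lborel" "g \<in> borel_measurable lborel"
    using f g by auto
  have m: "(\<lambda>p. g (fst p) * f (snd p)) \<in> borel_measurable (lborel \<Otimes>\<^sub>M lborel)"
    by measurable
  then show "(\<lambda>p. g (fst p) * f (snd p)) \<in> borel_measurable borel"
    by (simp add: lborel_prod)
  have "integrable (lborel \<Otimes>\<^sub>M lborel) (\<lambda>p. (g (fst p) * f (snd p))\<^sup>2)"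
  proof (rule lborel_pair.Fubini_integrable)
    show "integrable lborel (\<lambda>x. LINT y|lborel. norm ((g (fst (x, y)) * f (snd (x, y)))\<^sup>2))"
      using g by (simp add: power_mult_distrib)
    show "AE x in lborel. integrable lborel (\<lambda>y. (g (fst (x, y)) * f (snd (x, y)))\<^sup>2)"
      using f by (simp add: power_mult_distrib)
  qed (use m in measurable)
  then show "integrable lborel (\<lambda>p. (g (fst p) * f (snd p))\<^sup>2)"
    by (simp add: lborel_prod)
qed

text \<open>Both factors are square-integrable on the product space, so their product is integrable.
  This is the hypothesis under which Fubini is applied below.\<close>

lemma integrable_kernel_tensor:
  fixes K :: "'a::euclidean_space \<times> 'b::euclidean_space \<Rightarrow> real"
  assumes K: "K \<in> borel_measurable borel" "integrable lborel (\<lambda>p. (K p)\<^sup>2)"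
    and f: "f \<in> borel_measurable borel" "integrable lborel (\<lambda>x. (f x)\<^sup>2)"
    and g: "g \<in> borel_measurable borel" "integrable lborel (\<lambda>x. (g x)\<^sup>2)"
  shows "integrable lborel (\<lambda>p. K p * (g (fst p) * f (snd p)))"
proof -
  note fg = integrable_tensor_square[OF f g]
  have "(\<lambda>p. K p * (g (fst p) * f (snd p))) \<in> borel_measurable lborel"
    using borel_measurable_times[OF K(1) fg(1)] by simp
  from integrable_completion[OF this] show ?thesis
    using square_integrable_mult[OF square_integrable_borel[OF K] square_integrable_borel[OF fg]] by simp
qed

text \<open>The double integral on the right is the common form from which both the adjoint and the
  matrix coefficients are obtained.\<close>

lemma inner_kernel_operator:
  assumes K: "K \<in> borel_measurable borel" "integrable lborel (\<lambda>p. (K p)\<^sup>2)"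
    and f: "f \<in> borel_measurable borel" "integrable lborel (\<lambda>x. (f x)\<^sup>2)"
    and g: "g \<in> borel_measurable borel" "integrable lborel (\<lambda>x. (g x)\<^sup>2)"
  shows "inner (kernel_operator K (abs_L2 f)) (abs_L2 g) = (LINT p|lborel. K p * (g (fst p) * f (snd p)))"
proof -
  have "inner (kernel_operator K (abs_L2 f)) (abs_L2 g) = (LINT s|lborel. (LINT t|lborel. K (s, t) * f t) * g s)"
    using kernel_integral_square_bound(1)[OF K f] borel_measurable_kernel_integral[OF K(1) f(1)] K f g
    by (simp add: kernel_operator_abs_L2 inner_abs_L2_borel)
  \<comment> \<open>The factor \<open>g s\<close> moves inside for every \<open>s\<close>, even
    where the inner integrand is not integrable: both sides are then 0 by the default value of the
    integral.\<close>
  also have "\<dots> = (LINT s|lborel. (LINT t|lborel. K (s, t) * (g s * f t)))"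
    by (rule Bochner_Integration.integral_cong, rule refl, subst integral_mult_left_zero[symmetric],
      simp only: mult_ac)
  also have "\<dots> = (LINT p|lborel. K p * (g (fst p) * f (snd p)))"
    using integrable_kernel_tensor[OF K f g] lborel_pair.integral_fst'[of "\<lambda>p. K p * (g (fst p) * f (snd p))"]
    by (simp add: lborel_prod)
  finally show ?thesis .
qed

lemma swap_kernel:
  fixes K :: "'a::euclidean_space \<times> 'b::euclidean_space \<Rightarrow> real"
  assumes K: "K \<in> borel_measurable borel" "integrable lborel (\<lambda>p. (K p)\<^sup>2)"
  shows "K \<circ> prod.swap \<in> borel_measurable borel"
    and "integrable lborel (\<lambda>p. ((K \<circ> prod.swap) p)\<^sup>2)"
proof -
  have "K \<in> borel_measurable (lborel \<Otimes>\<^sub>M lborel)"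
    using K(1) by (rule borel_measurable_pair_lborel)
  from measurable_compose[OF measurable_pair_swap' this]
  show "K \<circ> prod.swap \<in> borel_measurable borel"
    by (simp add: lborel_prod case_prod_beta' comp_def prod.swap_def)
  show "integrable lborel (\<lambda>p. ((K \<circ> prod.swap) p)\<^sup>2)"
    using lborel_pair.integrable_product_swap[of "\<lambda>p. (K p)\<^sup>2"] K(2)
    by (simp add: lborel_prod case_prod_beta' prod.swap_def)
qed

lemma kernel_operator_adjoint:
  assumes K: "K \<in> borel_measurable borel" "integrable lborel (\<lambda>p. (K p)\<^sup>2)"
  shows "inner (kernel_operator K u) v = inner u (kernel_operator (K \<circ> prod.swap) v)"
proof -
  obtain f where f: "f \<in> borel_measurable borel" "integrable lborel (\<lambda>x. (f x)\<^sup>2)" "u = abs_L2 f"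
    by (rule L2_obtain_borel)
  obtain g where g: "g \<in> borel_measurable borel" "integrable lborel (\<lambda>x. (g x)\<^sup>2)" "v = abs_L2 g"
    by (rule L2_obtain_borel)
  note I = integrable_kernel_tensor[OF K f(1,2) g(1,2)]
  have "inner (kernel_operator K u) v = (LINT p|lborel. K p * (g (fst p) * f (snd p)))"
    using inner_kernel_operator[OF K f(1,2) g(1,2)] f(3) g(3) by simp
  also have "\<dots> = (LINT p|lborel. (K \<circ> prod.swap) p * (f (fst p) * g (snd p)))"
    using lborel_pair.integral_product_swap[of "\<lambda>p. K p * (g (fst p) * f (snd p))"] I
    by (simp add: lborel_prod case_prod_beta' prod.swap_def mult.commute borel_measurable_integrable)
  also have "\<dots> = inner (kernel_operator (K \<circ> prod.swap) v) u"
    unfolding f(3) g(3) by (rule inner_kernel_operator[OF swap_kernel[OF K] g(1,2) f(1,2), symmetric])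
  also have "\<dots> = inner u (kernel_operator (K \<circ> prod.swap) v)"
    by (rule inner_commute)
  finally show ?thesis .
qed

section \<open>Decay of the operator along an orthonormal sequence\<close>

lemma kernel_operator_bessel:
  fixes \<phi> :: "nat \<Rightarrow> 'a::euclidean_space L2"
  assumes K: "K \<in> borel_measurable borel" "integrable lborel (\<lambda>p. (K p)\<^sup>2)"
    and on: "\<forall>i j. inner (\<phi> i) (\<phi> j) = (if i = j then 1 else 0)"
  shows "(\<Sum>i<n. (norm (kernel_operator K (\<phi> i)))\<^sup>2) \<le> (LINT p|lborel. (K p)\<^sup>2)"
proof -
  have "\<exists>f. f \<in> borel_measurable borel \<and> integrable lborel (\<lambda>x. (f x)\<^sup>2) \<and> \<phi> i = abs_L2 f" for i
    by (rule L2_obtain_borel) blast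
  then obtain f where f: "\<And>i. f i \<in> borel_measurable borel" "\<And>i. integrable lborel (\<lambda>x. (f i x)\<^sup>2)"
    and \<phi>: "\<And>i. \<phi> i = abs_L2 (f i)"
    by metis
  note bound = kernel_integral_square_bound[OF K f]
  define F where "F i s = (LINT t|lborel. K (s, t) * f i t)" for i s
  have F: "F i \<in> borel_measurable borel" "integrable lborel (\<lambda>s. (F i s)\<^sup>2)" for i
    using borel_measurable_kernel_integral[OF K(1) f(1)] bound(1)[of i] by (simp_all add: F_def[abs_def])
  have "(norm (kernel_operator K (\<phi> i)))\<^sup>2 = (LINT s|lborel. (F i s)\<^sup>2)" for i
    unfolding \<phi> kernel_operator_abs_L2[OF K(1) f] F_def[symmetric] by (rule norm_abs_L2_borel[OF F])
  then have "(\<Sum>i<n. (norm (kernel_operator K (\<phi> i)))\<^sup>2) = (LINT s|lborel. (\<Sum>i<n. (F i s)\<^sup>2))"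
    using F by (simp add: Bochner_Integration.integral_sum)
  also have "\<dots> \<le> (LINT s|lborel. (LINT t|lborel. (K (s, t))\<^sup>2))"
  proof (rule integral_mono_AE)
    show "integrable lborel (\<lambda>s. LINT t|lborel. (K (s, t))\<^sup>2)"
      using K(2) lborel_pair.integrable_fst'[of "\<lambda>p. (K p)\<^sup>2"] by (simp add: lborel_prod)
    show "AE s in lborel. (\<Sum>i<n. (F i s)\<^sup>2) \<le> (LINT t|lborel. (K (s, t))\<^sup>2)"
      using AE_square_integrable_section[OF K(2)]
    proof eventually_elim
      case (elim s)
      note Ks = borel_measurable_section[OF K(1), of s] elim
      show ?case
        \<comment> \<open>For fixed \<open>s\<close>, the numbers \<open>F i s\<close> are the
          coefficients of the section \<open>K (s, _)\<close> along the \<open>\<phi> i\<close>; the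
          resulting bound does not depend on \<open>n\<close>.\<close>
        using bessel_inequality[OF on, of "abs_L2 (\<lambda>t. K (s, t))" n]
        unfolding \<phi> inner_abs_L2_borel[OF Ks f] norm_abs_L2_borel[OF Ks] F_def .
    qed
  qed (use F in simp)
  also have "\<dots> = (LINT p|lborel. (K p)\<^sup>2)"
    using K(2) lborel_pair.integral_fst'[of "\<lambda>p. (K p)\<^sup>2"] by (simp add: lborel_prod)
  finally show ?thesis .
qed

lemma kernel_operator_orthonormal_tendsto_0:
  fixes \<phi> :: "nat \<Rightarrow> 'a::euclidean_space L2"
  assumes K: "K \<in> borel_measurable borel" "integrable lborel (\<lambda>p. (K p)\<^sup>2)"
    and on: "\<forall>i j. inner (\<phi> i) (\<phi> j) = (if i = j then 1 else 0)"
  shows "(\<lambda>i. norm (kernel_operator K (\<phi> i))) \<longlonglongrightarrow> 0"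
proof -
  have "summable (\<lambda>i. (norm (kernel_operator K (\<phi> i)))\<^sup>2)"
    by (rule summableI_nonneg_bounded[OF _ kernel_operator_bessel[OF K on]]) simp
  from tendsto_real_sqrt[OF summable_LIMSEQ_zero[OF this]] show ?thesis
    by simp
qed

lemma kernel_operator_in_L2_on:
  assumes K: "K \<in> borel_measurable borel" "integrable lborel (\<lambda>p. (K p)\<^sup>2)"
    and supp: "\<And>s t. s \<notin> \<Omega> \<Longrightarrow> K (s, t) = 0"
  shows "kernel_operator K v \<in> L2_on \<Omega>"
proof -
  obtain f where f: "f \<in> borel_measurable borel" "integrable lborel (\<lambda>x. (f x)\<^sup>2)" "v = abs_L2 f"
    by (rule L2_obtain_borel)
  have "square_integrable (\<lambda>s. LINT t|lborel. K (s, t) * f t)"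
    using borel_measurable_kernel_integral[OF K(1) f(1)] kernel_integral_square_bound(1)[OF K f(1,2)]
    by (rule square_integrable_borel)
  from rep_L2_abs_L2[OF this] show ?thesis
    unfolding L2_on_def f(3) kernel_operator_abs_L2[OF K(1) f(1,2)] by (auto simp: supp)
qed

section \<open>From the given kernel on the domain to a Borel kernel on the whole space\<close>

lemma square_integrable_kernel_obtain_borel:
  fixes k :: "'a::euclidean_space \<Rightarrow> 'a \<Rightarrow> real"
  assumes \<Omega>: "\<Omega> \<in> sets borel" and k: "square_integrable_kernel \<Omega> k"
  obtains K where "K \<in> borel_measurable borel" "integrable lborel (\<lambda>p. (K p)\<^sup>2)"
    "\<And>s t. s \<notin> \<Omega> \<or> t \<notin> \<Omega> \<Longrightarrow> K (s, t) = 0"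
    "AE (s, t) in lborel. s \<in> \<Omega> \<longrightarrow> t \<in> \<Omega> \<longrightarrow> k s t = K (s, t)"
proof -
  have \<Omega>2: "\<Omega> \<times> \<Omega> \<in> sets borel" using borel_Times[OF \<Omega> \<Omega>] .
  define k0 where "k0 p = (if p \<in> \<Omega> \<times> \<Omega> then (\<lambda>(s, t). k s t) p else 0)" for p
  have k0: "square_integrable k0"
    unfolding k0_def[abs_def] using k \<Omega>2
    by (intro abs_L2_in_L2_on(1)) (auto simp: square_integrable_kernel_def case_prod_beta')
  then obtain K0 where K0: "K0 \<in> borel_measurable borel" "AE p in lborel. k0 p = K0 p"
    by (rule square_integrable_obtain_borel)
  \<comment> \<open>The representative \<open>K0\<close> may be nonzero on a null set off
    \<open>\<Omega> \<times> \<Omega>\<close>. Cutting it off again makes the support condition hold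
    at every point.\<close>
  define K where "K p = (if p \<in> \<Omega> \<times> \<Omega> then K0 p else 0)" for p
  have K: "K \<in> borel_measurable borel"
    unfolding K_def[abs_def] using K0(1) \<Omega>2 by measurable
  have ae: "AE p in lborel. k0 p = K p"
    using K0(2) by eventually_elim (auto simp: k0_def K_def split: if_splits)
  have "square_integrable K"
    using square_integrable_AE[OF k0 AE_completion[OF ae]] .
  then have "integrable lborel (\<lambda>p. (K p)\<^sup>2)"
    using K integrable_completion[of "\<lambda>p. (K p)\<^sup>2" lborel] by (simp add: square_integrable_def)
  moreover have "AE (s, t) in lborel. s \<in> \<Omega> \<longrightarrow> t \<in> \<Omega> \<longrightarrow> k s t = K (s, t)"
    using ae by eventually_elim (auto simp: k0_def)
  moreover have "K (s, t) = 0" if "s \<notin> \<Omega> \<or> t \<notin> \<Omega>" for s t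
    using that by (auto simp: K_def)
  ultimately show ?thesis
    using that[OF K] by blast
qed

text \<open>Lets integrands built from \<open>rep_L2\<close> or from the original kernel be replaced
  by Borel ones without a measurability hypothesis on them: completeness of Lebesgue measure
  supplies it.\<close>

lemma LINT_lebesgue_eq_lborel:
  fixes f g :: "'a::euclidean_space \<Rightarrow> real"
  assumes g: "g \<in> borel_measurable borel" and ae: "AE x in lborel. f x = g x"
  shows "(LINT x|lebesgue. f x) = (LINT x|lborel. g x)"
proof -
  have g': "g \<in> borel_measurable lebesgue" using g by (auto intro: measurable_completion)
  have ae': "AE x in lebesgue. f x = g x" using ae by (rule AE_completion)
  then have "f \<in> borel_measurable lebesgue"
    using borel_measurable_AE[OF g', of f] by (simp add: eq_commute)
  then have "(LINT x|lebesgue. f x) = (LINT x|lebesgue. g x)"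
    using g' ae' by (rule integral_cong_AE)
  then show ?thesis using g by (simp add: integral_completion)
qed

lemma AE_rep_L2_abs_L2_borel:
  assumes "f \<in> borel_measurable borel" "integrable lborel (\<lambda>x. (f x)\<^sup>2)"
  shows "AE x in lborel. rep_L2 (abs_L2 f) x = f x"
  using rep_L2_abs_L2[OF square_integrable_borel[OF assms]] by (simp add: AE_completion_iff)

lemma integral_operator_eq_kernel_operator:
  assumes \<Omega>: "\<Omega> \<in> sets borel"
    and K: "K \<in> borel_measurable borel" "integrable lborel (\<lambda>p. (K p)\<^sup>2)"
    and supp: "\<And>s t. s \<notin> \<Omega> \<or> t \<notin> \<Omega> \<Longrightarrow> K (s, t) = 0"
    and ae: "AE (s, t) in lborel. s \<in> \<Omega> \<longrightarrow> t \<in> \<Omega> \<longrightarrow> k s t = K (s, t)"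
  shows "integral_operator \<Omega> k v = kernel_operator K v"
proof -
  obtain f where f: "f \<in> borel_measurable borel" "integrable lborel (\<lambda>x. (f x)\<^sup>2)" "v = abs_L2 f"
    by (rule L2_obtain_borel)
  define F where "F s = (LINT t|lborel. K (s, t) * f t)" for s
  define G where "G s = (if s \<in> \<Omega> then LINT t|lebesgue_on \<Omega>. k s t * rep_L2 v t else 0)" for s
  have F: "square_integrable F"
    using borel_measurable_kernel_integral[OF K(1) f(1)] kernel_integral_square_bound(1)[OF K f(1,2)]
    unfolding F_def[abs_def] by (rule square_integrable_borel)
  \<comment> \<open>Almost every section of a null set is null, so for almost every \<open>s\<close>
    the two inner integrals agree.\<close>
  have "AE s in lborel. AE t in lborel. s \<in> \<Omega> \<longrightarrow> t \<in> \<Omega> \<longrightarrow> k s t = K (s, t)"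
    using lborel_pair.AE_pair[unfolded lborel_prod, OF ae] by simp
  then have "AE s in lborel. F s = G s"
  proof eventually_elim
    case (elim s)
    show ?case
    proof (cases "s \<in> \<Omega>")
      case True
      have "(LINT t|lebesgue_on \<Omega>. k s t * rep_L2 v t)
          = (LINT t|lebesgue. (if t \<in> \<Omega> then k s t * rep_L2 v t else 0))"
        using \<Omega> by (intro Lebesgue_Measure.integral_restrict_UNIV[symmetric]) simp
      also have "\<dots> = (LINT t|lborel. K (s, t) * f t)"
      proof (rule LINT_lebesgue_eq_lborel)
        show "(\<lambda>t. K (s, t) * f t) \<in> borel_measurable borel"
          by (intro borel_measurable_times borel_measurable_section K f)
        show "AE t in lborel. (if t \<in> \<Omega> then k s t * rep_L2 v t else 0) = K (s, t) * f t"
          using elim AE_rep_L2_abs_L2_borel[OF f(1,2)]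
          by eventually_elim (auto simp: True f(3) supp)
      qed
      finally show ?thesis using True by (simp add: F_def G_def)
    qed (simp add: F_def G_def supp)
  qed
  then have ae': "AE s in lebesgue. F s = G s" by (rule AE_completion)
  \<comment> \<open>Square-integrability of \<open>G\<close> is transferred from \<open>F\<close>;
    without it the class of \<open>G\<close> would carry no meaning.\<close>
  have "abs_L2 F = abs_L2 G"
    using F square_integrable_AE[OF F ae'] ae' by (rule abs_L2_eqI)
  then show ?thesis
    unfolding integral_operator_def kernel_operator_abs_L2[OF K(1) f(1,2)] f(3)[symmetric]
    using kernel_operator_abs_L2[OF K(1) f(1,2)] f(3) by (simp add: F_def[abs_def] G_def[abs_def])
qed

text \<open>Cylinders over null sets are null in the product. This carries changes of representative
  in one variable over to the double integral defining \<open>kernel_coeff\<close>.\<close>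

lemma AE_lborel_fst_snd:
  fixes P :: "'a::euclidean_space \<Rightarrow> bool" and Q :: "'b::euclidean_space \<Rightarrow> bool"
  assumes "AE x in lborel. P x" and "AE y in lborel. Q y"
  shows "AE p in lborel. P (fst p) \<and> Q (snd p)"
proof -
  obtain M where M: "M \<in> null_sets (lborel :: 'a measure)" "{x. \<not> P x} \<subseteq> M"
    using assms(1) by (auto simp: eventually_ae_filter)
  obtain N where N: "N \<in> null_sets (lborel :: 'b measure)" "{y. \<not> Q y} \<subseteq> N"
    using assms(2) by (auto simp: eventually_ae_filter)
  have "(M \<times> UNIV) \<union> (UNIV \<times> N) \<in> null_sets (lborel \<Otimes>\<^sub>M lborel)"
    using M(1) N(1) by (intro null_sets.Un lborel.times_in_null_sets1 lborel.times_in_null_sets2) auto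
  then show ?thesis
    unfolding lborel_prod using M(2) N(2) by (rule_tac AE_I') auto
qed

text \<open>The index order matters: \<open>i\<close> goes with the output variable \<open>s\<close>
  and \<open>j\<close> with the input variable \<open>t\<close>, so \<open>\<phi> j\<close> is the
  vector acted upon.\<close>

lemma kernel_coeff_eq_inner:
  assumes \<Omega>: "\<Omega> \<in> sets borel"
    and K: "K \<in> borel_measurable borel" "integrable lborel (\<lambda>p. (K p)\<^sup>2)"
    and supp: "\<And>s t. s \<notin> \<Omega> \<or> t \<notin> \<Omega> \<Longrightarrow> K (s, t) = 0"
    and ae: "AE (s, t) in lborel. s \<in> \<Omega> \<longrightarrow> t \<in> \<Omega> \<longrightarrow> k s t = K (s, t)"
  shows "kernel_coeff \<Omega> k \<phi> i j = inner (kernel_operator K (\<phi> j)) (\<phi> i)"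
proof -
  obtain f where f: "f \<in> borel_measurable borel" "integrable lborel (\<lambda>x. (f x)\<^sup>2)" "\<phi> j = abs_L2 f"
    by (rule L2_obtain_borel)
  obtain g where g: "g \<in> borel_measurable borel" "integrable lborel (\<lambda>x. (g x)\<^sup>2)" "\<phi> i = abs_L2 g"
    by (rule L2_obtain_borel)
  have "kernel_coeff \<Omega> k \<phi> i j = (LINT p|lebesgue. (if p \<in> \<Omega> \<times> \<Omega>
      then (\<lambda>(s, t). k s t * rep_L2 (\<phi> i) s * rep_L2 (\<phi> j) t) p else 0))"
    unfolding kernel_coeff_def using borel_Times[OF \<Omega> \<Omega>]
    by (intro Lebesgue_Measure.integral_restrict_UNIV[symmetric]) simp
  also have "\<dots> = (LINT p|lborel. K p * (g (fst p) * f (snd p)))"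
  proof (rule LINT_lebesgue_eq_lborel)
    show "(\<lambda>p. K p * (g (fst p) * f (snd p))) \<in> borel_measurable borel"
      by (intro borel_measurable_times[OF K(1)] integrable_tensor_square(1) f g)
    show "AE p in lborel. (if p \<in> \<Omega> \<times> \<Omega>
        then (\<lambda>(s, t). k s t * rep_L2 (\<phi> i) s * rep_L2 (\<phi> j) t) p else 0) = K p * (g (fst p) * f (snd p))"
      using ae AE_lborel_fst_snd[OF AE_rep_L2_abs_L2_borel[OF g(1,2)] AE_rep_L2_abs_L2_borel[OF f(1,2)]]
      by eventually_elim (auto simp: f(3) g(3) supp, use supp in blast, use supp in blast)
  qed
  also have "\<dots> = inner (kernel_operator K (\<phi> j)) (\<phi> i)"
    unfolding f(3) g(3) by (rule inner_kernel_operator[OF K f(1,2) g(1,2), symmetric])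
  finally show ?thesis .
qed

section \<open>Derivative, coderivative and covering constant of the integral operator\<close>

theorem theorem5p1:
  fixes \<Omega> :: "(real ^ 'n) set"
    and k :: "real ^ 'n \<Rightarrow> real ^ 'n \<Rightarrow> real"
    and \<phi> :: "nat \<Rightarrow> (real ^ 'n) L2"
  assumes "open \<Omega>" and "connected \<Omega>" and "\<Omega> \<noteq> {}"
    and "square_integrable_kernel \<Omega> k"
    and "orthonormal_basis_on (L2_on \<Omega>) \<phi>"
  defines "T \<equiv> integral_operator \<Omega> k"
    and "c \<equiv> kernel_coeff \<Omega> k \<phi>"
  shows
    "(\<forall>h\<in>L2_on \<Omega>.
        frechet_differentiable_on (L2_on \<Omega>) T h \<and>
        (\<forall>f\<in>L2_on \<Omega>.
           frechet_derivative_on (L2_on \<Omega>) T h f = T f \<and>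
           (\<forall>i. summable (\<lambda>j. c i j * inner f (\<phi> j))) \<and>
           (\<lambda>i. (\<Sum>j. c i j * inner f (\<phi> j)) *\<^sub>R \<phi> i) sums T f)) \<and>
     (\<forall>h\<in>L2_on \<Omega>.
        mordukhovich_differentiable_on (L2_on \<Omega>) T h \<and>
        (\<forall>g\<in>L2_on \<Omega>.
           coderivative_on (L2_on \<Omega>) T h g = {adjoint_on (L2_on \<Omega>) T g} \<and>
           (\<forall>j. summable (\<lambda>i. c i j * inner g (\<phi> i))) \<and>
           (\<lambda>j. (\<Sum>i. c i j * inner g (\<phi> i)) *\<^sub>R \<phi> j) sums adjoint_on (L2_on \<Omega>) T g)) \<and>
     (\<forall>f\<in>L2_on \<Omega>. \<forall>u\<in>L2_on \<Omega>. u = T f \<longrightarrow>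
        covering_constant_on (L2_on \<Omega>) T f u = 0)"
proof -
  let ?H = "L2_on \<Omega>"
  have \<Omega>: "\<Omega> \<in> sets borel" using assms(1) by (rule borel_open)
  obtain K where K: "K \<in> borel_measurable borel" "integrable lborel (\<lambda>p. (K p)\<^sup>2)"
    and supp: "\<And>s t. s \<notin> \<Omega> \<or> t \<notin> \<Omega> \<Longrightarrow> K (s, t) = 0"
    and ae: "AE (s, t) in lborel. s \<in> \<Omega> \<longrightarrow> t \<in> \<Omega> \<longrightarrow> k s t = K (s, t)"
    using square_integrable_kernel_obtain_borel[OF \<Omega> assms(4)] by blast
  note K' = swap_kernel[OF K]
  define S where "S = kernel_operator (K \<circ> prod.swap)"
  have T: "T v = kernel_operator K v" for v
    unfolding T_def by (rule integral_operator_eq_kernel_operator[OF \<Omega> K supp ae])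
  have TS: "inner (T u) v = inner u (S v)" for u v
    unfolding T S_def by (rule kernel_operator_adjoint[OF K])
  then have ST: "inner (S u) v = inner u (T v)" for u v
    by (metis inner_commute)
  have c: "c i j = inner (T (\<phi> j)) (\<phi> i)" for i j
    unfolding c_def T by (rule kernel_coeff_eq_inner[OF \<Omega> K supp ae])
  \<comment> \<open>The same coefficients read as the transposed matrix, that of \<open>S\<close>;
    this is the shape in which \<open>adjoint_sums\<close> applies with \<open>S\<close> and
    \<open>T\<close> exchanged.\<close>
  have c': "c i j = inner (S (\<phi> i)) (\<phi> j)" for i j
    unfolding c TS by (rule inner_commute)
  have TH: "T v \<in> ?H" for v
    unfolding T by (rule kernel_operator_in_L2_on[OF K]) (simp add: supp)
  \<comment> \<open>Here the support condition is used in the second variable, since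
    \<open>S\<close> has the transposed kernel.\<close>
  have SH: "S v \<in> ?H" for v
    unfolding S_def by (rule kernel_operator_in_L2_on[OF K']) (simp add: supp)
  have bl: "bounded_linear T"
    by (rule bounded_linear_of_adjoint[OF TS]) (unfold T, rule kernel_operator_norm_le[OF K])
  have H: "subspace ?H" by (rule subspace_L2_on)
  note B = assms(5)
  have on: "\<forall>i j. inner (\<phi> i) (\<phi> j) = (if i = j then 1 else 0)"
    using B by (simp add: orthonormal_basis_on_def)
  have adj: "adjoint_on ?H T g = S g" for g
    using H SH TS by (rule adjoint_on_eqI)
  have cod: "coderivative_on ?H T h g = {S g}" if "h \<in> ?H" for h g
    using H bl SH TS that by (rule coderivative_on_bounded_linear)
  have "has_frechet_derivative_on ?H T h T" for h
    using TH by (intro has_frechet_derivative_on_bounded_linear bl) auto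
  then have "frechet_differentiable_on ?H T h" for h
    unfolding frechet_differentiable_on_def by blast
  moreover have "frechet_derivative_on ?H T h f = T f" if "h \<in> ?H" "f \<in> ?H" for h f
    using H bl _ that by (rule frechet_derivative_on_bounded_linear) (use TH in blast)
  moreover have "summable (\<lambda>j. c i j * inner f (\<phi> j))"
    "(\<lambda>i. (\<Sum>j. c i j * inner f (\<phi> j)) *\<^sub>R \<phi> i) sums T f" if "f \<in> ?H" for f i
    unfolding c using adjoint_sums[OF B TS SH TH that] by blast+
  moreover have "mordukhovich_differentiable_on ?H T h" if "h \<in> ?H" for h
    using cod[OF that] by (simp add: mordukhovich_differentiable_on_def)
  moreover have "summable (\<lambda>i. c i j * inner g (\<phi> i))"
    "(\<lambda>j. (\<Sum>i. c i j * inner g (\<phi> i)) *\<^sub>R \<phi> j) sums S g" if "g \<in> ?H" for g j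
    unfolding c' using adjoint_sums[OF B ST TH SH that] by blast+
  moreover have "covering_constant_on ?H T f (T f) = 0" if "f \<in> ?H" for f
  proof (rule covering_constant_on_eq_0[OF H bl SH TS that, where w = \<phi>])
    show "\<phi> i \<in> ?H" for i using B by (rule orthonormal_basis_on_mem)
    show "norm (\<phi> i) = 1" for i using on by (simp add: norm_eq_sqrt_inner)
    show "(\<lambda>i. norm (S (\<phi> i))) \<longlonglongrightarrow> 0"
      unfolding S_def by (rule kernel_operator_orthonormal_tendsto_0[OF K' on])
  qed
  ultimately show ?thesis
    unfolding adj by (simp add: cod)
qed

end
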